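(* The monoid $\mathbb{G}$ (under composition of maps) is not finitely generated.
   Context: $\lambda$ is Lebesgue measure on $[0,1]$. A continuous map $h:[0,1]\to[0,1]$ is $\lambda$-preserving if $\lambda(A)=\lambda(h^{-1}(A))$ for every Borel set $A\subseteq[0,1]$. A dyadic number is a rational number whose denominator is an integer power of $2$. $\mathbb{G}$ ($\lambda$-preserving Thompson's monoid) is the set of continuous maps $g$ from $[0,1]$ onto $[0,1]$ such that: $g$ is $\lambda$-preserving; $g$ is piecewise affine; $g$ is differentiable except at finitely many points; the $x$-coordinate of each point of non-differentiability is dyadic; and on every interval where $g$ is differentiable, the derivative is of the form $\pm 2^k$ with $k\in\mathbb{Z}$. It is a monoid under composition with identity element $x\mapsto x$. *)

theory Defs
  imports "HOL-Analysis.Analysis" "HOL-Algebra.Group"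
begin

definition lambda_preserving :: "(real \<Rightarrow> real) \<Rightarrow> bool" where
  "lambda_preserving h \<longleftrightarrow>
     (\<forall>A \<in> sets borel. A \<subseteq> {0..1} \<longrightarrow> emeasure lborel A = emeasure lborel (h -` A \<inter> {0..1}))"

definition piecewise_affine :: "(real \<Rightarrow> real) \<Rightarrow> bool" where
  "piecewise_affine g \<longleftrightarrow>
     (\<exists>(n::nat) t. t 0 = 0 \<and> t n = 1 \<and> (\<forall>i<n. t i < t (Suc i)) \<and>
        (\<forall>i<n. \<exists>a b. \<forall>x \<in> {t i..t (Suc i)}. g x = a * x + b))"

(* Differentiability is relative to {0..1}, hence one-sided at the endpoints. *)
definition nondiff_points :: "(real \<Rightarrow> real) \<Rightarrow> real set" where
  "nondiff_points g = {x \<in> {0..1}. \<not> g differentiable (at x within {0..1})}"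

(* Maps from [0,1] to itself are represented by functions that are extensional on {0..1},
   so that HOL equality is equality of maps. The library's dyadics have nonnegative
   numerators, which are all that occur in [0,1]. *)
definition thompson_maps :: "(real \<Rightarrow> real) set" where
  "thompson_maps = {g \<in> extensional {0..1}.
     continuous_on {0..1} g \<and>
     g ` {0..1} = {0..1} \<and>
     lambda_preserving g \<and>
     piecewise_affine g \<and>
     finite (nondiff_points g) \<and>
     nondiff_points g \<subseteq> dyadics \<and>
     (\<forall>a b. 0 \<le> a \<and> a < b \<and> b \<le> 1 \<and> {a<..<b} \<inter> nondiff_points g = {} \<longrightarrow>
        (\<exists>(k::int) s. (s = 1 \<or> s = - 1) \<and>
           (\<forall>x \<in> {a<..<b}. (g has_real_derivative s * 2 powi k) (at x within {0..1}))))}"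

definition thompson_monoid :: "(real \<Rightarrow> real) monoid" where
  "thompson_monoid =
     \<lparr>carrier = thompson_maps, mult = compose {0..1}, one = (\<lambda>x\<in>{0..1}. x)\<rparr>"

(* The generate of HOL-Algebra also adjoins inverses, so it does not give submonoids. *)
inductive_set generate_monoid :: "('a, 'b) monoid_scheme \<Rightarrow> 'a set \<Rightarrow> 'a set"
  for M and S where
    one: "\<one>\<^bsub>M\<^esub> \<in> generate_monoid M S"
  | incl: "s \<in> S \<Longrightarrow> s \<in> generate_monoid M S"
  | mult: "x \<in> generate_monoid M S \<Longrightarrow> y \<in> generate_monoid M S \<Longrightarrow>
             x \<otimes>\<^bsub>M\<^esub> y \<in> generate_monoid M S"

definition finitely_generated_monoid :: "('a, 'b) monoid_scheme \<Rightarrow> bool" where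
  "finitely_generated_monoid M \<longleftrightarrow>
     (\<exists>S. finite S \<and> S \<subseteq> carrier M \<and> generate_monoid M S = carrier M)"

end

theory Submission
  imports Defs
begin

text \<open>
  The only injective elements of the monoid are \<open>x \<mapsto> x\<close> and \<open>x \<mapsto> 1 - x\<close>. If a product
  \<open>u \<circ> v\<close> is injective on both sides of a point \<open>c\<close>, then so is \<open>v\<close>; either \<open>v\<close> is globally
  injective, or it turns around at \<open>c\<close>, and then, being onto, it already covers the whole
  interval from one of the two sides, which forces \<open>u\<close> to be injective. Hence a map with a
  single fold is irreducible up to the two units. The maps that fold \<open>[0, d]\<close> onto itself by
  \<open>\<bar>2 x - d\<bar>\<close> and fix the remaining points, for \<open>d = 1 / 2 ^ n\<close>, give infinitely many of them,
  whereas finitely many generators yield only finitely many irreducibles.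
\<close>

section \<open>Rigidity of injective measure-preserving maps\<close>

text \<open>A continuous injection of an interval is strictly monotone, so the preimage of
  \<open>{0..h x}\<close> is \<open>{0..x}\<close> or \<open>{x..1}\<close>. Equality of lengths
  then determines \<open>h x\<close>.\<close>

lemma injective_lambda_preserving_cases:
  fixes h :: "real \<Rightarrow> real"
  assumes cont: "continuous_on {0..1} h" and inj: "inj_on h {0..1}"
    and onto: "h ` {0..1} = {0..1}" and pres: "lambda_preserving h"
  shows "(\<forall>x\<in>{0..1}. h x = x) \<or> (\<forall>x\<in>{0..1}. h x = 1 - x)"
proof -
  have measure_eq: "emeasure lborel {0..h x} = emeasure lborel (h -` {0..h x} \<inter> {0..1})"
    if "x \<in> {0..1}" for x
  proof -
    have "h x \<in> {0..1}" using onto that by blast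
    then show ?thesis using pres unfolding lambda_preserving_def by auto
  qed
  have range: "h x \<in> {0..1}" if "x \<in> {0..1}" for x using onto that by blast
  from cont inj have "strict_mono_on {0..1} h \<or> strict_antimono_on {0..1} h"
    using injective_eq_monotone_map[of "{0..1::real}" h] by (auto simp: is_interval_cc)
  then show ?thesis
  proof
    assume mono: "strict_mono_on {0..1} h"
    have lt: "h x < h y" if "x \<in> {0..1}" "y \<in> {0..1}" "x < y" for x y
      using mono that by (auto simp: monotone_on_def)
    have "h x = x" if x: "x \<in> {0..1}" for x
    proof -
      have "h y \<le> h x \<longleftrightarrow> y \<le> x" if "y \<in> {0..1}" for y
        using lt[of x y] lt[of y x] x that by (cases x y rule: linorder_cases) auto
      then have "y \<in> h -` {0..h x} \<inter> {0..1} \<longleftrightarrow> y \<in> {0..x}" for y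
        using range[of y] x by auto
      then have "h -` {0..h x} \<inter> {0..1} = {0..x}" by blast
      with measure_eq[OF x] range[OF x] x show ?thesis by simp
    qed
    then show ?thesis by blast
  next
    assume anti: "strict_antimono_on {0..1} h"
    have lt: "h y < h x" if "x \<in> {0..1}" "y \<in> {0..1}" "x < y" for x y
      using anti that by (auto simp: monotone_on_def)
    have "h x = 1 - x" if x: "x \<in> {0..1}" for x
    proof -
      have "h y \<le> h x \<longleftrightarrow> x \<le> y" if "y \<in> {0..1}" for y
        using lt[of x y] lt[of y x] x that by (cases x y rule: linorder_cases) auto
      then have "y \<in> h -` {0..h x} \<inter> {0..1} \<longleftrightarrow> y \<in> {x..1}" for y
        using range[of y] x by auto
      then have "h -` {0..h x} \<inter> {0..1} = {x..1}" by blast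
      with measure_eq[OF x] range[OF x] x show ?thesis by simp
    qed
    then show ?thesis by blast
  qed
qed

section \<open>Factorizations of maps with at most one fold\<close>

text \<open>The point \<open>c\<close> may be an endpoint, so injective maps qualify too: the
  condition means at most one fold. Induction over products then needs no separate treatment of
  isometries.\<close>

definition folds_once :: "(real \<Rightarrow> real) \<Rightarrow> bool" where
  "folds_once g \<longleftrightarrow> (\<exists>c\<in>{0..1}. inj_on g {0..c} \<and> inj_on g {c..1})"

lemma folds_once_compose_injective:
  fixes u v :: "real \<Rightarrow> real"
  assumes cont: "continuous_on {0..1} v" and onto: "v ` {0..1} = {0..1}"
    and fold: "folds_once (compose {0..1} u v)"
  shows "inj_on u {0..1} \<or> inj_on v {0..1}"
proof -
  obtain c where c: "c \<in> {0..1}" and left: "inj_on (compose {0..1} u v) {0..c}"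
    and right: "inj_on (compose {0..1} u v) {c..1}"
    using fold unfolding folds_once_def by blast
  have left': "inj_on (u \<circ> v) {0..c}"
    using left c by (subst inj_on_cong[of _ _ "compose {0..1} u v"]) (auto simp: compose_def)
  have right': "inj_on (u \<circ> v) {c..1}"
    using right c by (subst inj_on_cong[of _ _ "compose {0..1} u v"]) (auto simp: compose_def)
  have contL: "continuous_on {0..c} v" and contR: "continuous_on {c..1} v"
    using cont c by (auto intro: continuous_on_subset)
  \<comment> \<open>By connectedness, a half on which \<open>v\<close> takes both values 0 and 1 is
    mapped over all of \<open>{0..1}\<close>. Injectivity of \<open>u \<circ> v\<close> on that half
    therefore becomes injectivity of \<open>u\<close> everywhere.\<close>
  have covers: "inj_on u {0..1}"
    if "0 \<in> v ` J" "1 \<in> v ` J" "continuous_on J v" "connected J" "inj_on (u \<circ> v) J" for J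
  proof -
    have "{0..1} \<subseteq> v ` J"
      using that by (intro connected_contains_Icc connected_continuous_image) auto
    moreover have "inj_on u (v ` J)" using that by (intro inj_on_imageI)
    ultimately show ?thesis by (rule inj_on_subset[rotated])
  qed
  obtain z0 z1 where z: "z0 \<in> {0..1}" "v z0 = 0" "z1 \<in> {0..1}" "v z1 = 1"
  proof -
    have "0 \<in> v ` {0..1}" "1 \<in> v ` {0..1}" using onto by simp_all
    then show thesis using that by (auto simp: image_iff)
  qed
  have "v c \<in> {0..1}" using c onto by blast
  then have vc: "0 \<le> v c" "v c \<le> 1" by simp_all
  have dirL: "strict_mono_on {0..c} v \<or> strict_antimono_on {0..c} v"
    using injective_eq_monotone_map[of "{0..c}" v] contL inj_on_imageI2[OF left']
    by (auto simp: is_interval_cc)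
  have dirR: "strict_mono_on {c..1} v \<or> strict_antimono_on {c..1} v"
    using injective_eq_monotone_map[of "{c..1}" v] contR inj_on_imageI2[OF right']
    by (auto simp: is_interval_cc)
  have mono: "v x < v y" if "strict_mono_on J v" "x \<in> J" "y \<in> J" "x < y" for J x y
    using that by (auto simp: monotone_on_def)
  have anti: "v y < v x" if "strict_antimono_on J v" "x \<in> J" "y \<in> J" "x < y" for J x y
    using that by (auto simp: monotone_on_def)
  consider (up) "strict_mono_on {0..c} v" "strict_mono_on {c..1} v"
    | (down) "strict_antimono_on {0..c} v" "strict_antimono_on {c..1} v"
    | (peak) "strict_mono_on {0..c} v" "strict_antimono_on {c..1} v"
    | (valley) "strict_antimono_on {0..c} v" "strict_mono_on {c..1} v"
    using dirL dirR by blast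
  then show ?thesis
  proof cases
    case up
    \<comment> \<open>If \<open>c\<close> lies strictly between \<open>x\<close> and
      \<open>y\<close>, the comparison passes through \<open>v c\<close>.\<close>
    have "v x < v y" if "x \<in> {0..1}" "y \<in> {0..1}" "x < y" for x y
      using mono[OF up(1), of x y] mono[OF up(2), of x y] mono[OF up(1), of x c]
        mono[OF up(2), of c y] that c by (cases "y \<le> c"; cases "c \<le> x") auto
    then have "inj_on v {0..1}" by (intro linorder_inj_onI) (auto simp: less_imp_neq)
    then show ?thesis ..
  next
    case down
    have "v y < v x" if "x \<in> {0..1}" "y \<in> {0..1}" "x < y" for x y
      using anti[OF down(1), of x y] anti[OF down(2), of x y] anti[OF down(1), of x c]
        anti[OF down(2), of c y] that c by (cases "y \<le> c"; cases "c \<le> x") auto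
    then have "inj_on v {0..1}" by (intro linorder_inj_onI) (force dest: less_imp_neq)+
    then show ?thesis ..
  next
    case peak
    \<comment> \<open>If \<open>z1\<close> differed from \<open>c\<close>, monotonicity towards the
      peak would force \<open>v c > 1\<close>. So the peak has height 1, and whichever half contains
      \<open>z0\<close> attains both 0 and 1. The valley case is the mirror image.\<close>
    have "v c = 1"
      using mono[OF peak(1), of z1 c] anti[OF peak(2), of c z1] z vc c
      by (cases z1 c rule: linorder_cases) auto
    then show ?thesis
      using covers[OF _ _ contL _ left'] covers[OF _ _ contR _ right'] z c
      by (cases "z0 \<le> c") (force simp: image_iff)+
  next
    case valley
    have "v c = 0"
      using anti[OF valley(1), of z0 c] mono[OF valley(2), of c z0] z vc c
      by (cases z0 c rule: linorder_cases) auto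
    then show ?thesis
      using covers[OF _ _ contL _ left'] covers[OF _ _ contR _ right'] z c
      by (cases "z1 \<le> c") (force simp: image_iff)+
  qed
qed

text \<open>Restricted to \<open>{0..1}\<close> so that injective members of
  \<open>thompson_maps\<close> are literally equal to one of these two functions.\<close>

definition interval_isometries :: "(real \<Rightarrow> real) set" where
  "interval_isometries = {\<lambda>x\<in>{0..1}. x, \<lambda>x\<in>{0..1}. 1 - x}"

lemma compose_interval_isometries:
  assumes "p \<in> interval_isometries" "q \<in> interval_isometries"
  shows "compose {0..1} p q \<in> interval_isometries"
  using assms unfolding interval_isometries_def
  by (auto simp: compose_def restrict_def fun_eq_iff)

text \<open>This is irreducibility up to isometries. Rigidity identifies an injective factor on
  \<open>{0..1}\<close>, and extensionality turns that agreement into equality of functions.\<close>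

lemma thompson_factor_isometry:
  assumes u: "u \<in> thompson_maps" and v: "v \<in> thompson_maps"
    and fold: "folds_once (compose {0..1} u v)"
  shows "u \<in> interval_isometries \<or> v \<in> interval_isometries"
proof -
  have iso: "g \<in> interval_isometries" if g: "g \<in> thompson_maps" and inj: "inj_on g {0..1}" for g
  proof -
    have "(\<forall>x\<in>{0..1}. g x = x) \<or> (\<forall>x\<in>{0..1}. g x = 1 - x)"
      using g inj by (intro injective_lambda_preserving_cases) (auto simp: thompson_maps_def)
    moreover have "g \<in> extensional {0..1}" using g by (simp add: thompson_maps_def)
    ultimately show ?thesis
      unfolding interval_isometries_def by (auto simp: extensional_def restrict_def fun_eq_iff)
  qed
  have "inj_on u {0..1} \<or> inj_on v {0..1}"
    using v fold by (intro folds_once_compose_injective) (auto simp: thompson_maps_def)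
  then show ?thesis using iso u v by blast
qed

text \<open>Injectivity of a composite passes to its inner factor, so the same \<open>c\<close>
  serves.\<close>

lemma folds_once_left_isometry:
  assumes "p \<in> interval_isometries" "v ` {0..1} \<subseteq> {0..1}" "folds_once (compose {0..1} p v)"
  shows "folds_once v"
proof -
  obtain c where c: "c \<in> {0..1}" "inj_on (compose {0..1} p v) {0..c}"
    "inj_on (compose {0..1} p v) {c..1}"
    using assms(3) unfolding folds_once_def by blast
  have "inj_on v {0..c}"
    by (rule inj_onI, rule inj_onD[OF c(2)]) (use c(1) in \<open>auto simp: compose_def\<close>)
  moreover have "inj_on v {c..1}"
    by (rule inj_onI, rule inj_onD[OF c(3)]) (use c(1) in \<open>auto simp: compose_def\<close>)
  ultimately show ?thesis using c(1) unfolding folds_once_def by blast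
qed

text \<open>Precomposition with the reflection exchanges the two halves and moves the fold point
  from \<open>c\<close> to \<open>1 - c\<close>.\<close>

lemma folds_once_right_isometry:
  assumes "p \<in> interval_isometries" "folds_once (compose {0..1} u p)"
  shows "folds_once u"
proof -
  obtain c where c: "c \<in> {0..1}" "inj_on (compose {0..1} u p) {0..c}"
    "inj_on (compose {0..1} u p) {c..1}"
    using assms(2) unfolding folds_once_def by blast
  consider "p = (\<lambda>x\<in>{0..1}. x)" | "p = (\<lambda>x\<in>{0..1}. 1 - x)"
    using assms(1) unfolding interval_isometries_def by blast
  then show ?thesis
  proof cases
    case 1
    have "inj_on u {0..c}"
      by (rule inj_onI, rule inj_onD[OF c(2)]) (use c(1) 1 in \<open>auto simp: compose_def\<close>)
    moreover have "inj_on u {c..1}"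
      by (rule inj_onI, rule inj_onD[OF c(3)]) (use c(1) 1 in \<open>auto simp: compose_def\<close>)
    ultimately show ?thesis using c(1) unfolding folds_once_def by blast
  next
    case 2
    have "inj_on u {0..1 - c}"
    proof (rule inj_onI)
      fix x y assume "x \<in> {0..1 - c}" "y \<in> {0..1 - c}" "u x = u y"
      then have "1 - x = 1 - y"
        by - (rule inj_onD[OF c(3)], use c(1) 2 in \<open>auto simp: compose_def\<close>)
      then show "x = y" by simp
    qed
    moreover have "inj_on u {1 - c..1}"
    proof (rule inj_onI)
      fix x y assume "x \<in> {1 - c..1}" "y \<in> {1 - c..1}" "u x = u y"
      then have "1 - x = 1 - y"
        by - (rule inj_onD[OF c(2)], use c(1) 2 in \<open>auto simp: compose_def\<close>)
      then show "x = y" by simp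
    qed
    ultimately show ?thesis using c(1) unfolding folds_once_def
      by (intro bexI[of _ "1 - c"]) auto
  qed
qed

section \<open>Finitely many generators yield finitely many maps with at most one fold\<close>

text \<open>In a product with at most one fold, one factor is an isometry and the other again folds
  at most once. Inductively the latter is a generator, or the identity, between two isometries, and
  the new isometry is absorbed by the outer ones.\<close>

lemma finite_folds_once_generated:
  assumes fin: "finite S" and sub: "generate_monoid thompson_monoid S \<subseteq> thompson_maps"
  shows "finite {g \<in> generate_monoid thompson_monoid S. folds_once g}"
proof -
  let ?I = "{0..1::real}"
  let ?U = interval_isometries
  \<comment> \<open>The identity is adjoined so that the empty product has the normal form as
    well.\<close>
  define T where "T = insert \<one>\<^bsub>thompson_monoid\<^esub> S"
  \<comment> \<open>\<open>F\<close> serves only as a finite upper bound: the isometries in it need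
    not be generated by \<open>S\<close>.\<close>
  define F where "F = (\<lambda>(p, s, q). compose ?I p (compose ?I s q)) ` (?U \<times> T \<times> ?U)"
  have maps: "g ` ?I = ?I" "g \<in> extensional ?I" if "g \<in> generate_monoid thompson_monoid S" for g
  proof -
    from that sub have "g \<in> thompson_maps" by blast
    then show "g ` ?I = ?I" "g \<in> extensional ?I" by (simp_all add: thompson_maps_def)
  qed
  have Tsub: "s \<in> generate_monoid thompson_monoid S" if "s \<in> T" for s
    using that by (auto simp: T_def intro: generate_monoid.intros)
  have Urange: "q x \<in> ?I" if "q \<in> ?U" "x \<in> ?I" for q x
    using that by (auto simp: interval_isometries_def)
  have idU: "(\<lambda>x\<in>?I. x) \<in> ?U" by (simp add: interval_isometries_def)
  have TF: "s \<in> F" if "s \<in> T" for s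
  proof -
    have "compose ?I (\<lambda>x\<in>?I. x) (compose ?I s (\<lambda>x\<in>?I. x)) = s"
      using maps[OF Tsub[OF that]]
      by (force simp: compose_def restrict_def fun_eq_iff extensional_def)
    with idU that show ?thesis unfolding F_def by force
  qed
  have "folds_once g \<longrightarrow> g \<in> F" if "g \<in> generate_monoid thompson_monoid S" for g
    using that
  proof induction
    case one
    then show ?case using TF by (simp add: T_def)
  next
    case (incl s)
    then show ?case using TF by (simp add: T_def)
  next
    case (mult y z)
    have prod: "y \<otimes>\<^bsub>thompson_monoid\<^esub> z = compose ?I y z"
      by (simp add: thompson_monoid_def)
    show ?case
    proof
      assume "folds_once (y \<otimes>\<^bsub>thompson_monoid\<^esub> z)"
      then have fold: "folds_once (compose ?I y z)" by (simp add: prod)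
      have "y \<in> ?U \<or> z \<in> ?U"
        using mult.hyps sub fold by (intro thompson_factor_isometry) auto
      then show "y \<otimes>\<^bsub>thompson_monoid\<^esub> z \<in> F"
      proof
        assume y: "y \<in> ?U"
        have "z \<in> F"
          using folds_once_left_isometry[OF y _ fold] maps[OF mult.hyps(2)] mult.IH by auto
        then obtain p s q where psq: "p \<in> ?U" "s \<in> T" "q \<in> ?U"
          "z = compose ?I p (compose ?I s q)" by (auto simp: F_def)
        \<comment> \<open>\<open>compose\<close> restricts to \<open>{0..1}\<close>, so
          reassociating requires the inner values to stay there.\<close>
        have "s x \<in> ?I" if "x \<in> ?I" for x
          using maps(1)[OF Tsub[OF psq(2)]] that by blast
        then have "compose ?I y z = compose ?I (compose ?I y p) (compose ?I s q)"
          using Urange[OF psq(3)] by (auto simp: psq(4) compose_def restrict_def fun_eq_iff)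
        moreover have "compose ?I y p \<in> ?U" using y psq by (intro compose_interval_isometries)
        ultimately show ?thesis using psq unfolding prod F_def by force
      next
        assume z: "z \<in> ?U"
        have "y \<in> F" using folds_once_right_isometry[OF z fold] mult.IH by auto
        then obtain p s q where psq: "p \<in> ?U" "s \<in> T" "q \<in> ?U"
          "y = compose ?I p (compose ?I s q)" by (auto simp: F_def)
        have "compose ?I y z = compose ?I p (compose ?I s (compose ?I q z))"
          using Urange[OF z] by (auto simp: psq(4) compose_def restrict_def fun_eq_iff)
        moreover have "compose ?I q z \<in> ?U" using z psq by (intro compose_interval_isometries)
        ultimately show ?thesis using psq unfolding prod F_def by force
      qed
    qed
  qed
  moreover have "finite F"
    using fin by (simp add: F_def T_def interval_isometries_def)
  ultimately show ?thesis by (auto intro: finite_subset[of _ F])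
qed

section \<open>The family of fold maps\<close>

text \<open>The tent on \<open>{0..d}\<close> is upside down: it falls from \<open>d\<close> to 0 at
  \<open>d / 2\<close> and returns to \<open>d\<close>, so that it joins the identity
  continuously.\<close>

definition fold_map :: "real \<Rightarrow> real \<Rightarrow> real" where
  "fold_map d = (\<lambda>x\<in>{0..1}. if x \<le> d then \<bar>2 * x - d\<bar> else x)"

lemma fold_map_first: "0 \<le> x \<Longrightarrow> x \<le> d / 2 \<Longrightarrow> d \<le> 1 \<Longrightarrow> fold_map d x = d - 2 * x"
  and fold_map_second: "0 \<le> d \<Longrightarrow> d / 2 \<le> x \<Longrightarrow> x \<le> d \<Longrightarrow> d \<le> 1 \<Longrightarrow> fold_map d x = 2 * x - d"
  and fold_map_third: "0 \<le> d \<Longrightarrow> d \<le> x \<Longrightarrow> x \<le> 1 \<Longrightarrow> fold_map d x = x"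
  by (auto simp: fold_map_def)

text \<open>The fold is at \<open>d / 2\<close>. At \<open>d\<close> the slope only drops from 2 to
  1, so the map stays increasing on \<open>{d/2..1}\<close>.\<close>

lemma folds_once_fold_map:
  assumes "0 < d" "d < 1"
  shows "folds_once (fold_map d)"
proof -
  have "inj_on (fold_map d) {0..d/2}"
    using assms by (intro inj_onI) (auto simp: fold_map_first)
  moreover have "inj_on (fold_map d) {d/2..1}"
    using assms by (intro inj_onI) (auto simp: fold_map_def abs_if split: if_splits)
  ultimately show ?thesis
    using assms unfolding folds_once_def by (intro bexI[of _ "d / 2"]) auto
qed

lemma continuous_on_fold_map:
  assumes "0 < d" "d < 1"
  shows "continuous_on {0..1} (fold_map d)"
proof -
  have "continuous_on ({0..d} \<union> {d..1}) (\<lambda>x. if x \<le> d then \<bar>2 * x - d\<bar> else x)"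
    using assms by (intro continuous_on_If continuous_intros) auto
  moreover have "{0..d} \<union> {d..1} = {0..1}" using assms by auto
  ultimately show ?thesis
    by (subst continuous_on_cong[OF refl, of _ _ "\<lambda>x. if x \<le> d then \<bar>2 * x - d\<bar> else x"])
       (auto simp: fold_map_def)
qed

lemma image_fold_map:
  assumes "0 < d" "d < 1"
  shows "fold_map d ` {0..1} = {0..1}"
proof
  show "fold_map d ` {0..1} \<subseteq> {0..1}" using assms by (auto simp: fold_map_def)
  show "{0..1} \<subseteq> fold_map d ` {0..1}"
  proof
    fix y :: real assume y: "y \<in> {0..1}"
    show "y \<in> fold_map d ` {0..1}"
    proof (cases "y \<le> d")
      case True
      \<comment> \<open>The witness solves \<open>2 * x - d = y\<close> on the rising
        branch.\<close>
      with y assms show ?thesis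
        by (intro image_eqI[of _ _ "(y + d) / 2"]) (auto simp: fold_map_second field_simps)
    next
      case False
      with y assms show ?thesis
        by (intro image_eqI[of _ _ y]) (auto simp: fold_map_third)
    qed
  qed
qed

text \<open>Affine change of variables, applied to the indicator function of
  \<open>A\<close>.\<close>

lemma emeasure_lborel_affine_vimage:
  fixes c t :: real
  assumes A: "A \<in> sets borel" and "c \<noteq> 0"
  shows "emeasure lborel A = ennreal \<bar>c\<bar> * emeasure lborel ((\<lambda>x. t + c * x) -` A)"
proof -
  have meas: "(\<lambda>x. t + c * x) -` A \<in> sets borel"
    using A by (rule measurable_sets_borel[rotated]) simp
  have "emeasure lborel A = (\<integral>\<^sup>+x. indicator A x \<partial>lborel)" using A by simp
  also have "\<dots> = ennreal \<bar>c\<bar> * (\<integral>\<^sup>+x. indicator A (t + c * x) \<partial>lborel)"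
    using A assms(2) by (intro nn_integral_real_affine) auto
  also have "(\<lambda>x. indicator A (t + c * x) :: ennreal) = indicator ((\<lambda>x. t + c * x) -` A)"
    by (auto simp: indicator_def)
  finally show ?thesis using meas by simp
qed

text \<open>The part of \<open>A\<close> in \<open>{0..d}\<close> has two preimages, one on each
  branch of slope 2 or -2, and each has half its measure. The rest of \<open>A\<close> is fixed
  pointwise.\<close>

lemma lambda_preserving_fold_map:
  assumes d: "0 < d" "d < 1"
  shows "lambda_preserving (fold_map d)"
  unfolding lambda_preserving_def
proof (intro ballI impI)
  fix A :: "real set" assume A: "A \<in> sets borel" "A \<subseteq> {0..1}"
  define B where "B = A \<inter> {0..d}"
  define C where "C = A \<inter> {d<..1}"
  define L where "L = (\<lambda>x. d + (- 2) * x) -` B"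
  define R where "R = (\<lambda>x. - d + 2 * x) -` B"
  have meas [measurable]: "B \<in> sets borel" "C \<in> sets borel"
    using A(1) by (simp_all add: B_def C_def)
  have [measurable]: "L \<in> sets borel" "R \<in> sets borel"
    unfolding L_def R_def by (rule measurable_sets_borel[rotated, OF meas(1)]; simp)+
  have "emeasure lborel A = emeasure lborel (B \<union> C)"
    using A by (intro arg_cong[of _ _ "emeasure lborel"]) (auto simp: B_def C_def)
  also have "\<dots> = emeasure lborel B + emeasure lborel C"
    by (rule plus_emeasure[symmetric]) (simp, simp, force simp: B_def C_def)
  also have "emeasure lborel B = emeasure lborel L + emeasure lborel R"
  proof -
    have l: "emeasure lborel B = 2 * emeasure lborel L"
      using emeasure_lborel_affine_vimage[of B "- 2" d] by (simp add: L_def)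
    have r: "emeasure lborel B = 2 * emeasure lborel R"
      using emeasure_lborel_affine_vimage[of B 2 "- d"] by (simp add: R_def)
    have "emeasure lborel L = emeasure lborel R"
      using l r by (simp add: ennreal_mult_cancel_left)
    with l show ?thesis by (simp add: mult_2)
  qed
  also have "emeasure lborel L + emeasure lborel R = emeasure lborel (L \<union> R)"
  proof -
    \<comment> \<open>The two branches can share only the fold point, so their overlap is
      null.\<close>
    have "L \<inter> R \<subseteq> {d / 2}" by (auto simp: L_def R_def B_def)
    then have "emeasure lborel (L \<inter> R) = 0"
      by (rule emeasure_lborel_countable[OF countable_subset]) simp
    then have "L \<inter> R \<in> null_sets lborel" by (simp add: null_setsI)
    then show ?thesis using emeasure_Un'[of L lborel R] by simp
  qed
  also have "emeasure lborel (L \<union> R) + emeasure lborel C = emeasure lborel (L \<union> R \<union> C)"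
    by (rule plus_emeasure) (simp, simp, force simp: L_def R_def B_def C_def)
  also have "L \<union> R \<union> C = fold_map d -` A \<inter> {0..1}"
  proof (intro equalityI subsetI)
    fix x assume "x \<in> L \<union> R \<union> C"
    then show "x \<in> fold_map d -` A \<inter> {0..1}"
      using d by (auto simp: L_def R_def B_def C_def fold_map_def abs_if algebra_simps)
  next
    fix x assume "x \<in> fold_map d -` A \<inter> {0..1}"
    then show "x \<in> L \<union> R \<union> C"
      using d by (auto simp: L_def R_def B_def C_def fold_map_def abs_if algebra_simps
          split: if_splits)
  qed
  finally show "emeasure lborel A = emeasure lborel (fold_map d -` A \<inter> {0..1})" .
qed

lemma piecewise_affine_fold_map:
  assumes "0 < d" "d < 1"
  shows "piecewise_affine (fold_map d)"
proof -
  define t :: "nat \<Rightarrow> real" where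
    "t i = (if i = 0 then 0 else if i = 1 then d / 2 else if i = 2 then d else 1)" for i
  have less3: "i < 3 \<longleftrightarrow> i = 0 \<or> i = 1 \<or> i = 2" for i :: nat by auto
  have "\<forall>i<3. t i < t (Suc i)" using assms by (auto simp: less3 t_def)
  moreover have "\<exists>a b. \<forall>x\<in>{t i..t (Suc i)}. fold_map d x = a * x + b"
    if i: "i < 3" for i
  proof -
    consider "i = 0" | "i = 1" | "i = 2" using i less3[of i] by blast
    then show ?thesis
    proof cases
      case 1
      then show ?thesis
        using assms by (intro exI[of _ "- 2"] exI[of _ d]) (auto simp: t_def fold_map_first)
    next
      case 2
      then show ?thesis
        using assms by (intro exI[of _ 2] exI[of _ "- d"]) (auto simp: t_def fold_map_second)
    next
      case 3
      then show ?thesis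
        using assms by (intro exI[of _ 1] exI[of _ 0]) (auto simp: t_def fold_map_third)
    qed
  qed
  ultimately show ?thesis
    unfolding piecewise_affine_def by (intro exI[of _ 3] exI[of _ t]) (auto simp: t_def)
qed

lemma has_real_derivative_fold_map:
  assumes d: "0 < d" "d < 1" and x: "x \<in> {0..1}"
  shows "x < d / 2 \<Longrightarrow> (fold_map d has_real_derivative - 2) (at x within {0..1})"
    and "d / 2 < x \<Longrightarrow> x < d \<Longrightarrow> (fold_map d has_real_derivative 2) (at x within {0..1})"
    and "d < x \<Longrightarrow> (fold_map d has_real_derivative 1) (at x within {0..1})"
proof -
  \<comment> \<open>An affine formula valid near \<open>x\<close> relative to \<open>{0..1}\<close>
    gives the derivative. Taking rays for \<open>J\<close> in the outer pieces covers the endpoints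
    0 and 1 as well.\<close>
  have local: "(fold_map d has_real_derivative a) (at x within {0..1})"
    if "open J" "x \<in> J" "\<And>y. y \<in> {0..1} \<inter> J \<Longrightarrow> fold_map d y = a * y + b" for J a b
  proof -
    have "((\<lambda>y. a * y + b) has_real_derivative a) (at x within {0..1} \<inter> J)"
      by (auto intro!: derivative_eq_intros)
    then have "(fold_map d has_real_derivative a) (at x within {0..1} \<inter> J)"
      by (rule has_field_derivative_transform_within[OF _ zero_less_one]) (use x that in auto)
    then show ?thesis
      using at_within_nhd[of x J "{0..1} \<inter> J" "{0..1}"] that by (simp add: Int_assoc)
  qed
  show "(fold_map d has_real_derivative - 2) (at x within {0..1})" if "x < d / 2"
    by (rule local[of "{..<d / 2}" _ d]) (use that d in \<open>auto simp: fold_map_first\<close>)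
  show "(fold_map d has_real_derivative 2) (at x within {0..1})" if "d / 2 < x" "x < d"
    by (rule local[of "{d / 2<..<d}" _ "- d"]) (use that d in \<open>auto simp: fold_map_second\<close>)
  show "(fold_map d has_real_derivative 1) (at x within {0..1})" if "d < x"
    by (rule local[of "{d<..}" _ 0]) (use that d in \<open>auto simp: fold_map_third\<close>)
qed

text \<open>A derivative within \<open>S\<close> would also be the derivative within each one-sided
  interval, where it is unique and equals the slope. The two slopes differ.\<close>

lemma not_differentiable_at_kink:
  fixes f :: "real \<Rightarrow> real"
  assumes "l < x" "x < r" "{l..r} \<subseteq> S"
    and left: "\<And>y. y \<in> {l..x} \<Longrightarrow> f y = a * y + b"
    and right: "\<And>y. y \<in> {x..r} \<Longrightarrow> f y = a' * y + b'"
    and "a \<noteq> a'"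
  shows "\<not> f differentiable (at x within S)"
proof
  assume "f differentiable (at x within S)"
  then obtain D where D: "(f has_real_derivative D) (at x within S)"
    by (rule real_differentiableE)
  have unique: "D = e"
    if J: "J \<subseteq> S" "x \<in> J" "at x within J \<noteq> bot" and eq: "\<And>y. y \<in> J \<Longrightarrow> f y = e * y + k"
    for J e k
  proof -
    have "((\<lambda>y. e * y + k) has_real_derivative e) (at x within J)"
      by (auto intro!: derivative_eq_intros)
    then have "(f has_real_derivative e) (at x within J)"
      by (rule has_field_derivative_transform_within[OF _ zero_less_one]) (use J eq in auto)
    moreover have "(f has_real_derivative D) (at x within J)"
      using D J(1) by (rule has_field_derivative_subset)
    ultimately show ?thesis
      using J(3) by (intro has_field_derivative_unique)
  qed
  have "D = a"
    by (rule unique[of "{l..x}"]) (use assms in \<open>auto simp: at_within_Icc_at_left\<close>)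
  moreover have "D = a'"
    by (rule unique[of "{x..r}"]) (use assms in \<open>auto simp: at_within_Icc_at_right\<close>)
  ultimately show False using \<open>a \<noteq> a'\<close> by simp
qed

text \<open>Equality matters: one inclusion gives finiteness and dyadicity, the other ensures that
  an interval avoiding \<open>nondiff_points\<close> lies within a single affine piece.\<close>

lemma nondiff_points_fold_map:
  assumes d: "0 < d" "d < 1"
  shows "nondiff_points (fold_map d) = {d / 2, d}"
proof (intro equalityI subsetI)
  fix x assume x: "x \<in> nondiff_points (fold_map d)"
  show "x \<in> {d / 2, d}"
  proof (rule ccontr)
    assume "x \<notin> {d / 2, d}"
    then have "x < d / 2 \<or> d / 2 < x \<and> x < d \<or> d < x" by auto
    then have "\<exists>D. (fold_map d has_real_derivative D) (at x within {0..1})"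
      using has_real_derivative_fold_map[OF d] x unfolding nondiff_points_def by blast
    with x show False
      unfolding nondiff_points_def by (auto simp: real_differentiable_def)
  qed
next
  fix x assume "x \<in> {d / 2, d}"
  moreover have "\<not> fold_map d differentiable (at (d / 2) within {0..1})"
    by (rule not_differentiable_at_kink[of 0 _ d _ _ "- 2" d 2 "- d"])
       (use d in \<open>auto simp: fold_map_first fold_map_second\<close>)
  moreover have "\<not> fold_map d differentiable (at d within {0..1})"
    by (rule not_differentiable_at_kink[of "d / 2" _ 1 _ _ 2 "- d" 1 0])
       (use d in \<open>auto simp: fold_map_second fold_map_third\<close>)
  ultimately show "x \<in> nondiff_points (fold_map d)"
    using d by (auto simp: nondiff_points_def)
qed

lemma fold_map_in_thompson_maps:
  assumes d: "0 < d" "d < 1" and dyadic: "d \<in> dyadics" "d / 2 \<in> dyadics"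
  shows "fold_map d \<in> thompson_maps"
proof -
  let ?has_slope = "\<lambda>a b. \<exists>(k::int) s. (s = 1 \<or> s = - 1) \<and>
    (\<forall>x \<in> {a<..<b}. (fold_map d has_real_derivative s * 2 powi k) (at x within {0..1}))"
  have "?has_slope a b"
    if ab: "0 \<le> a" "a < b" "b \<le> 1" "{a<..<b} \<inter> nondiff_points (fold_map d) = {}" for a b
  proof -
    have sub: "x \<in> {0..1}" if "x \<in> {a<..<b}" for x using that ab by auto
    have "d / 2 \<notin> {a<..<b}" "d \<notin> {a<..<b}"
      using ab(4) unfolding nondiff_points_fold_map[OF d] by auto
    \<comment> \<open>The interval lies in one of the three pieces, whose slopes are
      \<open>- (2 powi 1)\<close>, \<open>2 powi 1\<close> and \<open>2 powi 0\<close>.\<close>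
    then consider "b \<le> d / 2" | "d / 2 \<le> a" "b \<le> d" | "d \<le> a" by force
    then show ?thesis
    proof cases
      case 1
      then show ?thesis using has_real_derivative_fold_map(1)[OF d sub]
        by (intro exI[of _ 1] exI[of _ "- 1"]) auto
    next
      case 2
      then show ?thesis using has_real_derivative_fold_map(2)[OF d sub]
        by (intro exI[of _ 1] exI[of _ 1]) auto
    next
      case 3
      then show ?thesis using has_real_derivative_fold_map(3)[OF d sub]
        by (intro exI[of _ 0] exI[of _ 1]) auto
    qed
  qed
  then show ?thesis
    unfolding thompson_maps_def
    using continuous_on_fold_map[OF d] image_fold_map[OF d] lambda_preserving_fold_map[OF d]
      piecewise_affine_fold_map[OF d] dyadic nondiff_points_fold_map[OF d]
    by (auto simp: fold_map_def)
qed

section \<open>Infinitely many fold maps against finitely many generators\<close>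

theorem theorem35:
  shows "\<not> finitely_generated_monoid thompson_monoid"
proof
  assume "finitely_generated_monoid thompson_monoid"
  then obtain S where S: "finite S" "generate_monoid thompson_monoid S = thompson_maps"
    unfolding finitely_generated_monoid_def by (auto simp: thompson_monoid_def)
  have fin: "finite {g \<in> thompson_maps. folds_once g}"
    using finite_folds_once_generated[OF S(1)] S(2) by simp
  \<comment> \<open>The exponent \<open>Suc n\<close> keeps \<open>d\<close> strictly below 1; both
    kinks, at \<open>d\<close> and \<open>d / 2\<close>, are dyadic.\<close>
  let ?g = "\<lambda>n::nat. fold_map (1 / 2 ^ Suc n)"
  have "inj ?g"
  proof (rule injI)
    fix m n assume "?g m = ?g n"
    \<comment> \<open>The value at 0 is \<open>d\<close> itself, so it recovers the
      parameter.\<close>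
    then have "?g m 0 = ?g n 0" by simp
    then show "m = n" by (simp add: fold_map_def)
  qed
  moreover have "range ?g \<subseteq> {g \<in> thompson_maps. folds_once g}"
  proof (rule image_subsetI)
    fix n :: nat
    have d: "(0::real) < 1 / 2 ^ Suc n" "1 / 2 ^ Suc n < (1::real)"
      using one_less_power[of "2::real" "Suc n"] by (auto simp del: power_Suc)
    have dyadic: "(1::real) / 2 ^ k \<in> dyadics" for k
      unfolding dyadics_def by (rule UN_I[where a = k], simp, rule UN_I[where a = 1], simp_all)
    have "(1::real) / 2 ^ Suc n / 2 \<in> dyadics" using dyadic[of "Suc (Suc n)"] by simp
    then show "?g n \<in> {g \<in> thompson_maps. folds_once g}"
      using fold_map_in_thompson_maps[OF d dyadic] folds_once_fold_map[OF d] by blast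
  qed
  ultimately show False
    using fin finite_subset finite_imageD infinite_UNIV_nat by blast
qed

end
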